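(* Let $n\ge2$, let $F_n$ be the free group on $z_1,\dots,z_n$, let $V_m=(v_1,\dots,v_m)$ be a tuple of words in $F_n$ at least one of which is nontrivial in $F_n$, and let $N$ be the normal closure of $\{v_1,\dots,v_m\}$ in $F_n$. Let $a,b$ be words in $F_n$. Then $FTL_{s2}(F_n,V_m,a)$ and $FTL_{s2}(F_n,V_m,b)$ are Hurwitz equivalent if and only if $a^{-1}b\in N$.
   Context: Conjugation notation: $a^b=b^{-1}ab$. An element $A$ of a free group has a root if $A=w^k$ for some $w$ and some integer $k\neq\pm1$. For $G_1\oplus G_2$, $R=(R_1,\dots,R_p)$, $W=(W_1,\dots,W_q)$, $H$ in $G_1$ and $X=(X_1,\dots,X_{q+2})$ in $G_2$, let $P_X(R,W,H)=((R_1,1),\dots,(R_p,1),(W_1,X_1),\dots,(W_q,X_q),(H^{-1},X_{q+1}),(H,X_{q+2}))$. Let $F_X$ be free on $X_1,\dots,X_{n+1}$ and fix an injective homomorphism $i:F_n\oplus F_X\to F_2\oplus F_2$. For a word $c$ in $F_n$, $FTL_{s1}(F_n,V_m,c)=i(P_X(V_f,W,c))$ with $V_f=(v_1,\dots,v_m,(v_1\cdots v_m)^{-1})$, $W=(z_1,\dots,z_n,(z_1\cdots z_n)^{-1})$, $X=(X_1,\dots,X_n,(X_1\cdots X_n)^{-1},X_{n+1}^{-1},X_{n+1})$. Fix an element $H\in N$ with no root (one exists), and define $FTL_{s2}(F_n,V_m,c)=FTL_{s1}(F_n,V_m,H^c)$. The braid group acts on the right on tuples by $(f_1,\dots,f_k)\sigma_i=(\dots,f_{i-1},f_{i+1},f_{i+1}^{-1}f_if_{i+1},f_{i+2},\dots)$,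 $(f_1,\dots,f_k)\sigma_i^{-1}=(\dots,f_{i-1},f_if_{i+1}f_i^{-1},f_i,f_{i+2},\dots)$; Hurwitz equivalent means in the same orbit. *)

theory Defs
  imports "HOL-Algebra.Generated_Groups"
begin

section \<open>Free groups\<close>

text \<open>
  The letter \<open>(x, True)\<close> stands for the generator \<open>x\<close>, and \<open>(x, False)\<close> for its inverse.
  An element of the free group on \<open>A\<close> is represented by the unique freely reduced word for it.
\<close>

type_synonym 'a word = "('a \<times> bool) list"

definition letter_inv :: "'a \<times> bool \<Rightarrow> 'a \<times> bool" where
  "letter_inv x = (fst x, \<not> snd x)"

definition reduced :: "'a word \<Rightarrow> bool" where
  "reduced w \<longleftrightarrow> successively (\<lambda>x y. y \<noteq> letter_inv x) w"

fun cancel_Cons :: "'a \<times> bool \<Rightarrow> 'a word \<Rightarrow> 'a word" where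
  "cancel_Cons x [] = [x]"
| "cancel_Cons x (y # w) = (if y = letter_inv x then w else x # y # w)"

definition reduce :: "'a word \<Rightarrow> 'a word" where
  "reduce w = foldr cancel_Cons w []"

definition free_group :: "'a set \<Rightarrow> 'a word monoid" where
  "free_group A =
    \<lparr> carrier = {w. reduced w \<and> fst ` set w \<subseteq> A},
      mult = (\<lambda>u v. reduce (u @ v)),
      one = [] \<rparr>"

definition gen :: "'a \<Rightarrow> 'a word" where
  "gen x = [(x, True)]"

lemma letter_inv_inv [simp]: "letter_inv (letter_inv x) = x"
  by (simp add: letter_inv_def)

lemma fst_letter_inv [simp]: "fst (letter_inv x) = fst x"
  by (simp add: letter_inv_def)

lemma letter_inv_neq [simp]: "letter_inv x \<noteq> x" "x \<noteq> letter_inv x"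
  by (cases x; simp add: letter_inv_def)+

lemma reduced_Nil [simp]: "reduced []"
  by (simp add: reduced_def)

lemma reduced_Cons: "reduced (x # w) \<longleftrightarrow> (w = [] \<or> hd w \<noteq> letter_inv x) \<and> reduced w"
  by (auto simp: reduced_def successively_Cons)

lemma reduced_cancel_Cons: "reduced w \<Longrightarrow> reduced (cancel_Cons x w)"
  by (cases w) (auto simp: reduced_Cons)

lemma reduced_foldr_cancel: "reduced v \<Longrightarrow> reduced (foldr cancel_Cons u v)"
  by (induction u) (auto intro: reduced_cancel_Cons)

lemma set_cancel_Cons: "set (cancel_Cons x w) \<subseteq> insert x (set w)"
  by (cases w) auto

lemma set_foldr_cancel: "set (foldr cancel_Cons u v) \<subseteq> set u \<union> set v"
  by (induction u) (use set_cancel_Cons in fastforce)+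

lemma cancel_Cons_letter_inv:
  assumes "reduced w"
  shows "cancel_Cons x (cancel_Cons (letter_inv x) w) = w"
proof (cases w)
  case (Cons y v)
  then show ?thesis
    using assms by (cases v) (auto simp: reduced_Cons)
qed simp

lemma cancel_Cons_letter_inv':
  "reduced w \<Longrightarrow> cancel_Cons (letter_inv x) (cancel_Cons x w) = w"
  using cancel_Cons_letter_inv [of w "letter_inv x"] by simp

lemma reduce_reduced: "reduced w \<Longrightarrow> reduce w = w"
proof (induction w)
  case (Cons x w)
  then show ?case
    by (cases w) (auto simp: reduce_def reduced_Cons)
qed (simp add: reduce_def)

lemma foldr_cancel_cancel_Cons:
  "reduced v \<Longrightarrow> foldr cancel_Cons (cancel_Cons x u) v = cancel_Cons x (foldr cancel_Cons u v)"
  by (cases u) (auto simp: cancel_Cons_letter_inv reduced_foldr_cancel)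

lemma foldr_cancel_reduce: "reduced v \<Longrightarrow> foldr cancel_Cons (reduce u) v = foldr cancel_Cons u v"
  by (induction u) (auto simp: reduce_def foldr_cancel_cancel_Cons)

lemma reduce_append_left: "reduce (reduce u @ v) = reduce (u @ v)"
  using foldr_cancel_reduce [of "reduce v" u]
  by (simp add: reduce_def reduced_foldr_cancel)

lemma reduce_append_right: "reduce (u @ reduce v) = reduce (u @ v)"
  using reduce_reduced [of "reduce v"] by (simp add: reduce_def reduced_foldr_cancel)

lemma reduced_reduce: "reduced (reduce w)"
  by (simp add: reduce_def reduced_foldr_cancel)

lemma set_reduce: "set (reduce w) \<subseteq> set w"
  using set_foldr_cancel [of w "[]"] by (simp add: reduce_def)

lemma reduce_letter_inv_append: "reduce (rev (map letter_inv w) @ w) = []"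
proof (induction w)
  case (Cons x w)
  have "reduce (rev (map letter_inv (x # w)) @ x # w)
      = foldr cancel_Cons (rev (map letter_inv w))
          (cancel_Cons (letter_inv x) (cancel_Cons x (reduce w)))"
    by (simp add: reduce_def)
  also have "\<dots> = reduce (rev (map letter_inv w) @ w)"
    by (simp add: cancel_Cons_letter_inv' reduced_reduce) (simp add: reduce_def)
  finally show ?case
    using Cons.IH by simp
qed (simp add: reduce_def)

lemma group_free_group: "group (free_group A)"
proof (rule groupI)
  fix u v assume "u \<in> carrier (free_group A)" "v \<in> carrier (free_group A)"
  then show "u \<otimes>\<^bsub>free_group A\<^esub> v \<in> carrier (free_group A)"
    using set_reduce [of "u @ v"] by (fastforce simp: free_group_def reduced_reduce)
next
  fix u v w
  show "u \<otimes>\<^bsub>free_group A\<^esub> v \<otimes>\<^bsub>free_group A\<^esub> w = u \<otimes>\<^bsub>free_group A\<^esub> (v \<otimes>\<^bsub>free_group A\<^esub> w)"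
    by (simp add: free_group_def reduce_append_left reduce_append_right)
next
  fix w assume w: "w \<in> carrier (free_group A)"
  let ?v = "reduce (rev (map letter_inv w))"
  have "?v \<in> carrier (free_group A)"
    using w set_reduce [of "rev (map letter_inv w)"]
    by (fastforce simp: free_group_def reduced_reduce)
  moreover have "?v \<otimes>\<^bsub>free_group A\<^esub> w = \<one>\<^bsub>free_group A\<^esub>"
    by (simp add: free_group_def reduce_append_left reduce_letter_inv_append)
  ultimately show "\<exists>v\<in>carrier (free_group A). v \<otimes>\<^bsub>free_group A\<^esub> w = \<one>\<^bsub>free_group A\<^esub>"
    by blast
qed (auto simp: free_group_def reduce_reduced)

abbreviation Fr :: "nat \<Rightarrow> nat word monoid" where
  "Fr n \<equiv> free_group {1..n}"


section \<open>Notions for arbitrary groups\<close>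

definition conj_by :: "('a, 'm) monoid_scheme \<Rightarrow> 'a \<Rightarrow> 'a \<Rightarrow> 'a" where
  "conj_by G a b = inv\<^bsub>G\<^esub> b \<otimes>\<^bsub>G\<^esub> a \<otimes>\<^bsub>G\<^esub> b"

definition has_root :: "('a, 'm) monoid_scheme \<Rightarrow> 'a \<Rightarrow> bool" where
  "has_root G A \<longleftrightarrow>
    (\<exists>w\<in>carrier G. \<exists>k::int. k \<noteq> 1 \<and> k \<noteq> - 1 \<and> A = w [^]\<^bsub>G\<^esub> k)"

definition normal_closure :: "('a, 'm) monoid_scheme \<Rightarrow> 'a set \<Rightarrow> 'a set" where
  "normal_closure G S = \<Inter> {N. N \<lhd> G \<and> S \<subseteq> N}"

definition list_prod :: "('a, 'm) monoid_scheme \<Rightarrow> 'a list \<Rightarrow> 'a" where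
  "list_prod G xs = foldr (mult G) xs \<one>\<^bsub>G\<^esub>"


section \<open>Hurwitz action of the braid group\<close>

text \<open>
  Strands are numbered from \<open>1\<close> and list positions from \<open>0\<close>, so the entries
  \<open>f\<^sub>i\<close> and \<open>f\<^sub>i\<^sub>+\<^sub>1\<close> of \<open>fs\<close> are \<open>fs ! (i - 1)\<close> and \<open>fs ! i\<close>.
\<close>

definition sigma :: "('a, 'm) monoid_scheme \<Rightarrow> nat \<Rightarrow> 'a list \<Rightarrow> 'a list" where
  "sigma G i fs =
    fs[i - 1 := fs ! i, i := inv\<^bsub>G\<^esub> (fs ! i) \<otimes>\<^bsub>G\<^esub> fs ! (i - 1) \<otimes>\<^bsub>G\<^esub> fs ! i]"

definition sigma_inv :: "('a, 'm) monoid_scheme \<Rightarrow> nat \<Rightarrow> 'a list \<Rightarrow> 'a list" where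
  "sigma_inv G i fs =
    fs[i - 1 := fs ! (i - 1) \<otimes>\<^bsub>G\<^esub> fs ! i \<otimes>\<^bsub>G\<^esub> inv\<^bsub>G\<^esub> (fs ! (i - 1)), i := fs ! (i - 1)]"

text \<open>
  Elements of the braid group are given by words in its generators, the letter \<open>(i, True)\<close>
  standing for \<open>\<sigma>\<^sub>i\<close> and \<open>(i, False)\<close> for its inverse. This is a right action: the leftmost
  letter acts first.
\<close>

definition braid_act :: "('a, 'm) monoid_scheme \<Rightarrow> 'a list \<Rightarrow> nat word \<Rightarrow> 'a list" where
  "braid_act G fs \<beta> =
    fold (\<lambda>(i, s) gs. if s then sigma G i gs else sigma_inv G i gs) \<beta> fs"

definition hurwitz_equiv :: "('a, 'm) monoid_scheme \<Rightarrow> 'a list \<Rightarrow> 'a list \<Rightarrow> bool" where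
  "hurwitz_equiv G fs gs \<longleftrightarrow>
    (\<exists>\<beta>. fst ` set \<beta> \<subseteq> {1..<length fs} \<and> gs = braid_act G fs \<beta>)"


section \<open>The tuples\<close>

text \<open>For \<open>W\<close> of length \<open>q\<close>, the tuple \<open>X\<close> is meant to have length \<open>q + 2\<close>.\<close>

definition P_tuple ::
  "('a, 'm) monoid_scheme \<Rightarrow> ('b, 'k) monoid_scheme \<Rightarrow> 'b list \<Rightarrow> 'a list \<Rightarrow> 'a list \<Rightarrow> 'a
    \<Rightarrow> ('a \<times> 'b) list" where
  "P_tuple G1 G2 X R W H =
    map (\<lambda>r. (r, \<one>\<^bsub>G2\<^esub>)) R @ zip W (take (length W) X)
      @ [(inv\<^bsub>G1\<^esub> H, X ! length W), (H, X ! (length W + 1))]"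

definition close_up :: "('a, 'm) monoid_scheme \<Rightarrow> 'a list \<Rightarrow> 'a list" where
  "close_up G xs = xs @ [inv\<^bsub>G\<^esub> (list_prod G xs)]"

definition gens :: "nat \<Rightarrow> nat word list" where
  "gens n = map gen [1..<n + 1]"

definition FTL_s1 ::
  "(nat word \<times> nat word \<Rightarrow> 'c) \<Rightarrow> nat \<Rightarrow> nat word list \<Rightarrow> nat word \<Rightarrow> 'c list" where
  "FTL_s1 \<iota> n V c =
    map \<iota> (P_tuple (Fr n) (Fr (n + 1))
      (close_up (Fr (n + 1)) (gens n) @ [inv\<^bsub>Fr (n + 1)\<^esub> (gen (n + 1)), gen (n + 1)])
      (close_up (Fr n) V) (close_up (Fr n) (gens n)) c)"

text \<open>The rootless element \<open>H\<close> and the embedding \<open>\<iota>\<close>, fixed once and for all in the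
  mathematical text, are explicit parameters.\<close>

definition FTL_s2 ::
  "(nat word \<times> nat word \<Rightarrow> 'c) \<Rightarrow> nat word \<Rightarrow> nat \<Rightarrow> nat word list \<Rightarrow> nat word \<Rightarrow> 'c list" where
  "FTL_s2 \<iota> H n V c = FTL_s1 \<iota> n V (conj_by (Fr n) H c)"

end

theory Submission
  imports Defs
begin

text \<open>
  The embedding does not affect Hurwitz equivalence, so one works in \<open>F\<^sub>n \<oplus> F\<^sub>X\<close>. Write \<open>c = H\<^sup>a\<close>, \<open>d = H\<^sup>b\<close>.

  A block of entries with product \<open>1\<close> may be conjugated in place by anything the remaining entries
  generate. Conjugating the block of the \<open>(v\<^sub>j, 1)\<close> by a lift of \<open>w\<close>, then the last two entries by
  \<open>(v\<^sub>j\<^sup>w, 1)\<close>, then the first block back, replaces \<open>c\<close> by its conjugate by \<open>v\<^sub>j\<^sup>w\<close>; hence \<open>c\<close> may be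
  conjugated by all of \<open>N\<close>.

  Conversely, every entry of an equivalent tuple is \<open>x\<^sup>g\<close> with \<open>x\<close> an original entry and \<open>g\<close> in the
  subgroup generated by the entries. The exponent sum in \<open>X\<^sub>n\<^sub>+\<^sub>1\<close> shows that \<open>(d, X\<^sub>n\<^sub>+\<^sub>1)\<close> comes from
  \<open>(c, X\<^sub>n\<^sub>+\<^sub>1)\<close>, so the second component of \<open>g\<close> centralizes \<open>X\<^sub>n\<^sub>+\<^sub>1\<close> and is a power of it. Since the first
  component of \<open>g\<close> agrees modulo \<open>N\<close> with the image of the second under \<open>X\<^sub>i \<mapsto> z\<^sub>i\<close>, \<open>X\<^sub>n\<^sub>+\<^sub>1 \<mapsto> 1\<close>, it lies
  in \<open>N\<close>. Thus \<open>H\<^sup>b = H\<^sup>a\<^sup>\<nu>\<close> with \<open>\<nu> \<in> N\<close>, and \<open>a \<nu> b\<^sup>-\<^sup>1\<close> centralizes the rootless \<open>H\<close>, so it is a power of \<open>H \<in> N\<close>.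
\<close>

section \<open>Conjugation and the Hurwitz action\<close>

context group
begin

section \<open>Conjugation as a right action by automorphisms\<close>

lemma conj_by_closed [simp]:
  "x \<in> carrier G \<Longrightarrow> y \<in> carrier G \<Longrightarrow> conj_by G x y \<in> carrier G"
  by (simp add: conj_by_def)

lemma conj_by_one_right [simp]: "x \<in> carrier G \<Longrightarrow> conj_by G x \<one> = x"
  by (simp add: conj_by_def)

lemma conj_by_one_left [simp]: "g \<in> carrier G \<Longrightarrow> conj_by G \<one> g = \<one>"
  by (simp add: conj_by_def)

lemma conj_by_mult_right:
  assumes "x \<in> carrier G" "g \<in> carrier G" "h \<in> carrier G"
  shows "conj_by G x (g \<otimes> h) = conj_by G (conj_by G x g) h"
  using assms by (simp add: conj_by_def inv_mult_group m_assoc)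

lemma conj_by_mult_left:
  assumes "x \<in> carrier G" "y \<in> carrier G" "g \<in> carrier G"
  shows "conj_by G (x \<otimes> y) g = conj_by G x g \<otimes> conj_by G y g"
proof -
  have "g \<otimes> (inv g \<otimes> (y \<otimes> g)) = y \<otimes> g"
    using assms by (simp flip: m_assoc)
  with assms show ?thesis by (simp add: conj_by_def m_assoc)
qed

lemma conj_by_conj_by_inv [simp]:
  "x \<in> carrier G \<Longrightarrow> g \<in> carrier G \<Longrightarrow> conj_by G (conj_by G x g) (inv g) = x"
  "x \<in> carrier G \<Longrightarrow> g \<in> carrier G \<Longrightarrow> conj_by G (conj_by G x (inv g)) g = x"
  by (simp_all flip: conj_by_mult_right)

lemma inv_conj_by:
  "x \<in> carrier G \<Longrightarrow> g \<in> carrier G \<Longrightarrow> inv (conj_by G x g) = conj_by G (inv x) g"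
  by (simp add: conj_by_def inv_mult_group m_assoc)

lemma conj_by_eq_self_iff:
  "x \<in> carrier G \<Longrightarrow> g \<in> carrier G \<Longrightarrow> conj_by G x g = x \<longleftrightarrow> x \<otimes> g = g \<otimes> x"
  by (simp add: conj_by_def m_assoc inv_solve_left')

section \<open>Products of lists\<close>

lemma list_prod_closed [simp]: "set xs \<subseteq> carrier G \<Longrightarrow> list_prod G xs \<in> carrier G"
  by (induction xs) (auto simp: list_prod_def)

lemma list_prod_append:
  "set xs \<subseteq> carrier G \<Longrightarrow> set ys \<subseteq> carrier G \<Longrightarrow>
    list_prod G (xs @ ys) = list_prod G xs \<otimes> list_prod G ys"
proof (induction xs)
  case (Cons x xs)
  then show ?case
    using list_prod_closed [of xs] list_prod_closed [of ys]
    by (simp add: list_prod_def m_assoc)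
qed (use list_prod_closed [of ys] in \<open>simp add: list_prod_def\<close>)

lemma list_prod_close_up: "set xs \<subseteq> carrier G \<Longrightarrow> list_prod G (close_up G xs) = \<one>"
  by (simp add: close_up_def list_prod_append) (simp add: list_prod_def [of G "[_]"])

lemma set_close_up: "set xs \<subseteq> carrier G \<Longrightarrow> set (close_up G xs) \<subseteq> carrier G"
  by (simp add: close_up_def)

lemma list_prod_map_conj_by:
  assumes "set xs \<subseteq> carrier G" "g \<in> carrier G"
  shows "list_prod G (map (\<lambda>x. conj_by G x g) xs) = conj_by G (list_prod G xs) g"
  using assms
proof (induction xs)
  case (Cons x xs)
  then show ?case
    using list_prod_closed [of xs] by (simp add: list_prod_def conj_by_mult_left)
qed (simp add: list_prod_def)

section \<open>Elementary braid moves and their orbits\<close>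

lemma sigma_append:
  "sigma G (Suc (length P)) (P @ x # y # Q) = P @ y # conj_by G x y # Q"
  by (simp add: sigma_def conj_by_def list_update_append nth_append)

lemma sigma_inv_append:
  assumes "x \<in> carrier G"
  shows "sigma_inv G (Suc (length P)) (P @ x # y # Q) = P @ conj_by G y (inv x) # x # Q"
  using assms by (simp add: sigma_inv_def conj_by_def list_update_append nth_append)

text \<open>A braid letter touches only two adjacent entries, so splitting the tuple around them
  replaces index arithmetic by list patterns. The induction runs over the braid word with the
  starting tuple generalized, since the leftmost letter acts first.\<close>

lemma hurwitz_equiv_induct [consumes 2, case_names refl sigma sigma_inv]:
  assumes "hurwitz_equiv G fs gs" and "set fs \<subseteq> carrier G"
    and "\<Phi> fs"
    and sigma: "\<And>P x y Q. set (P @ x # y # Q) \<subseteq> carrier G \<Longrightarrow> \<Phi> (P @ x # y # Q)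
      \<Longrightarrow> \<Phi> (P @ y # conj_by G x y # Q)"
    and sigma_inv: "\<And>P x y Q. set (P @ x # y # Q) \<subseteq> carrier G \<Longrightarrow> \<Phi> (P @ x # y # Q)
      \<Longrightarrow> \<Phi> (P @ conj_by G y (inv x) # x # Q)"
  shows "\<Phi> gs"
proof -
  obtain \<beta> where \<beta>: "fst ` set \<beta> \<subseteq> {1..<length fs}" "gs = braid_act G fs \<beta>"
    using assms(1) by (auto simp: hurwitz_equiv_def)
  have "\<Phi> (braid_act G fs \<beta>)"
    using \<beta>(1) assms(2,3)
  proof (induction \<beta> arbitrary: fs)
    case Nil
    then show ?case by (simp add: braid_act_def)
  next
    case (Cons s \<beta>)
    obtain i t where s: "s = (i, t)" by (cases s)
    with Cons.prems have i: "1 \<le> i" "i < length fs" by auto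
    define P Q where "P = take (i - 1) fs" and "Q = drop (Suc i) fs"
    have "i - 1 < length fs" "Suc (i - 1) = i" using i by auto
    then have fs: "fs = P @ fs ! (i - 1) # fs ! i # Q"
      unfolding P_def Q_def using id_take_nth_drop [of "i - 1" fs] i by (simp add: Cons_nth_drop_Suc)
    have iP: "i = Suc (length P)" using i by (simp add: P_def)
    obtain x y where fs: "fs = P @ x # y # Q" using fs by blast
    let ?hs = "if t then sigma G i fs else sigma_inv G i fs"
    have hs: "?hs = (if t then P @ y # conj_by G x y # Q else P @ conj_by G y (inv x) # x # Q)"
      using Cons.prems(2) by (simp add: fs iP sigma_append sigma_inv_append)
    have "\<Phi> ?hs" "set ?hs \<subseteq> carrier G" "length ?hs = length fs"
      unfolding hs using Cons.prems sigma [of P x y Q] sigma_inv [of P x y Q] by (auto simp: fs)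
    with Cons.IH [of ?hs] Cons.prems(1) show ?case
      by (simp add: braid_act_def s)
  qed
  then show ?thesis using \<beta>(2) by simp
qed

lemma hurwitz_equiv_closed:
  assumes "hurwitz_equiv G fs gs" "set fs \<subseteq> carrier G"
  shows "set gs \<subseteq> carrier G" "length gs = length fs"
proof -
  have "set gs \<subseteq> carrier G \<and> length gs = length fs"
    using assms by (induction rule: hurwitz_equiv_induct) (use assms in auto)
  then show "set gs \<subseteq> carrier G" "length gs = length fs" by auto
qed

lemma hurwitz_equiv_refl: "hurwitz_equiv G fs fs"
  by (auto simp: hurwitz_equiv_def braid_act_def intro!: exI [of _ "[]"])

lemma hurwitz_equiv_trans:
  assumes "hurwitz_equiv G fs gs" "hurwitz_equiv G gs hs" "set fs \<subseteq> carrier G"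
  shows "hurwitz_equiv G fs hs"
proof -
  obtain \<beta> where \<beta>: "fst ` set \<beta> \<subseteq> {1..<length fs}" "gs = braid_act G fs \<beta>"
    using assms(1) by (auto simp: hurwitz_equiv_def)
  obtain \<gamma> where \<gamma>: "fst ` set \<gamma> \<subseteq> {1..<length gs}" "hs = braid_act G gs \<gamma>"
    using assms(2) by (auto simp: hurwitz_equiv_def)
  have "fst ` set (\<beta> @ \<gamma>) \<subseteq> {1..<length fs}" "hs = braid_act G fs (\<beta> @ \<gamma>)"
    using \<beta> \<gamma> hurwitz_equiv_closed(2) [OF assms(1,3)] by (auto simp: braid_act_def)
  then show ?thesis unfolding hurwitz_equiv_def by blast
qed

lemma hurwitz_equiv_sigma: "hurwitz_equiv G (P @ x # y # Q) (P @ y # conj_by G x y # Q)"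
  unfolding hurwitz_equiv_def
  by (rule exI [of _ "[(Suc (length P), True)]"]) (simp add: braid_act_def sigma_append)

lemma hurwitz_equiv_sigma_inv:
  "x \<in> carrier G \<Longrightarrow> hurwitz_equiv G (P @ x # y # Q) (P @ conj_by G y (inv x) # x # Q)"
  unfolding hurwitz_equiv_def
  by (rule exI [of _ "[(Suc (length P), False)]"]) (simp add: braid_act_def sigma_inv_append)

lemma hurwitz_equiv_sym:
  assumes "hurwitz_equiv G fs gs" "set fs \<subseteq> carrier G"
  shows "hurwitz_equiv G gs fs"
  using assms
proof (induction rule: hurwitz_equiv_induct)
  case refl
  show ?case by (rule hurwitz_equiv_refl)
next
  case (sigma P x y Q)
  have "hurwitz_equiv G (P @ y # conj_by G x y # Q) (P @ x # y # Q)"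
    using hurwitz_equiv_sigma_inv [of y P "conj_by G x y" Q] sigma(1) by simp
  from hurwitz_equiv_trans [OF this sigma(2)] sigma(1) show ?case
    by simp
next
  case (sigma_inv P x y Q)
  have "hurwitz_equiv G (P @ conj_by G y (inv x) # x # Q) (P @ x # y # Q)"
    using hurwitz_equiv_sigma [of P "conj_by G y (inv x)" x Q] sigma_inv(1) by simp
  from hurwitz_equiv_trans [OF this sigma_inv(2)] sigma_inv(1) show ?case
    by simp
qed

text \<open>A move only conjugates an entry by another entry or its inverse, and all entries stay in
  \<open>K\<close>. Keeping the conjugator inside \<open>K\<close> is what later makes the orbit
  carry information.\<close>

lemma hurwitz_equiv_conj_by_subgroup:
  assumes "hurwitz_equiv G fs gs" "subgroup K G" "set fs \<subseteq> K" "y \<in> set gs"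
  shows "\<exists>x\<in>set fs. \<exists>g\<in>K. y = conj_by G x g"
proof -
  interpret K: subgroup K G by fact
  let ?C = "{conj_by G x g | x g. x \<in> set fs \<and> g \<in> K}"
  have CK: "?C \<subseteq> K" using assms(3) by (auto simp: conj_by_def)
  have C: "conj_by G z g \<in> ?C" if z_mem: "z \<in> ?C" and g: "g \<in> K" for z g
  proof -
    obtain x h where z: "z = conj_by G x h" "x \<in> set fs" "h \<in> K" using z_mem by auto
    then have "conj_by G z g = conj_by G x (h \<otimes> g)"
      using assms(3) g by (subst conj_by_mult_right) auto
    then show ?thesis using z g by blast
  qed
  have "set fs \<subseteq> carrier G" using assms(3) K.subset by blast
  with assms(1) have "set gs \<subseteq> ?C"
  proof (induction rule: hurwitz_equiv_induct)
    case refl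
    show ?case
    proof
      fix x assume "x \<in> set fs"
      moreover from this have "x = conj_by G x \<one>"
        using assms(3) by (simp add: subset_iff)
      ultimately show "x \<in> ?C" using K.one_closed by blast
    qed
  next
    case (sigma P x y Q)
    then have "conj_by G x y \<in> ?C" using CK by (intro C) auto
    with sigma show ?case by auto
  next
    case (sigma_inv P x y Q)
    then have "conj_by G y (inv x) \<in> ?C" using CK by (intro C) auto
    with sigma_inv show ?case by auto
  qed
  then show ?thesis using assms(4) by blast
qed

section \<open>Moving and conjugating blocks with trivial product\<close>

lemma hurwitz_equiv_move_left:
  assumes "set (P @ f # B @ Q) \<subseteq> carrier G" "list_prod G B = \<one>"
  shows "hurwitz_equiv G (P @ f # B @ Q) (P @ B @ f # Q)"
proof -
  \<comment> \<open>The induction needs blocks of arbitrary product, because a tail of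
    \<open>B\<close> need not multiply to 1. The entry \<open>f\<close> collects the conjugations
    while the block stays unchanged.\<close>
  have "hurwitz_equiv G (P @ f # B @ Q) (P @ B @ conj_by G f (list_prod G B) # Q)"
    using assms(1)
  proof (induction B arbitrary: P f)
    case Nil
    then show ?case by (simp add: list_prod_def hurwitz_equiv_refl)
  next
    case (Cons x B)
    have "hurwitz_equiv G ((P @ [x]) @ conj_by G f x # B @ Q)
       ((P @ [x]) @ B @ conj_by G (conj_by G f x) (list_prod G B) # Q)"
      using Cons.prems by (intro Cons.IH) auto
    moreover have "conj_by G (conj_by G f x) (list_prod G B) = conj_by G f (list_prod G (x # B))"
      using Cons.prems list_prod_closed [of B]
      by (simp add: list_prod_def conj_by_mult_right)
    ultimately have "hurwitz_equiv G (P @ x # conj_by G f x # B @ Q)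
       (P @ (x # B) @ conj_by G f (list_prod G (x # B)) # Q)"
      by simp
    from hurwitz_equiv_trans [OF hurwitz_equiv_sigma this] show ?case
      using Cons.prems by simp
  qed
  with assms show ?thesis by simp
qed

lemma hurwitz_equiv_move_left_list:
  assumes "set (P @ L @ B @ Q) \<subseteq> carrier G" "list_prod G B = \<one>"
  shows "hurwitz_equiv G (P @ L @ B @ Q) (P @ B @ L @ Q)"
  using assms(1)
proof (induction L arbitrary: P)
  case Nil
  then show ?case by (simp add: hurwitz_equiv_refl)
next
  case (Cons f L)
  have "hurwitz_equiv G ((P @ [f]) @ L @ B @ Q) ((P @ [f]) @ B @ L @ Q)"
    using Cons.prems by (intro Cons.IH) auto
  then have "hurwitz_equiv G (P @ f # L @ B @ Q) (P @ f # B @ L @ Q)"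
    by simp
  moreover have "hurwitz_equiv G (P @ f # B @ L @ Q) (P @ B @ f # L @ Q)"
    using Cons.prems assms(2) by (intro hurwitz_equiv_move_left) auto
  ultimately have "hurwitz_equiv G (P @ f # L @ B @ Q) (P @ B @ f # L @ Q)"
    by (rule hurwitz_equiv_trans) (use Cons.prems in auto)
  then show ?case by simp
qed

text \<open>Here \<open>f\<close> travels leftwards unchanged and every entry it passes is
  conjugated. Reverse induction fits, since the last entry of the block meets \<open>f\<close>
  first.\<close>

lemma hurwitz_equiv_move_right_conj_by:
  assumes "set (P @ B @ f # Q) \<subseteq> carrier G"
  shows "hurwitz_equiv G (P @ B @ f # Q) (P @ f # map (\<lambda>x. conj_by G x f) B @ Q)"
  using assms
proof (induction B arbitrary: Q rule: rev_induct)
  case Nil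
  then show ?case by (simp add: hurwitz_equiv_refl)
next
  case (snoc x B)
  have IH: "hurwitz_equiv G (P @ B @ f # conj_by G x f # Q)
     (P @ f # map (\<lambda>x. conj_by G x f) B @ conj_by G x f # Q)"
    using snoc.prems by (intro snoc.IH) auto
  have "hurwitz_equiv G (P @ B @ x # f # Q) (P @ B @ f # conj_by G x f # Q)"
    using hurwitz_equiv_sigma [of "P @ B" x f Q] by simp
  from this IH have "hurwitz_equiv G (P @ B @ x # f # Q)
     (P @ f # map (\<lambda>x. conj_by G x f) B @ conj_by G x f # Q)"
    by (rule hurwitz_equiv_trans) (use snoc.prems in auto)
  then show ?case by simp
qed

text \<open>A block with product \<open>1\<close> passes unchanged through its neighbours in one direction and gets
  conjugated by them in the other; comparing the two ways conjugates the block in place.\<close>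

lemma hurwitz_equiv_conj_by_mem:
  assumes "set (P @ B @ Q) \<subseteq> carrier G" "list_prod G B = \<one>" "f \<in> set (P @ Q)"
  shows "hurwitz_equiv G (P @ B @ Q) (P @ map (\<lambda>x. conj_by G x f) B @ Q)"
proof -
  let ?B = "map (\<lambda>x. conj_by G x f) B"
  have f: "f \<in> carrier G" using assms by auto
  have B: "list_prod G ?B = \<one>" "set ?B \<subseteq> carrier G"
    using assms f by (auto simp: list_prod_map_conj_by)
  have *: "hurwitz_equiv G (L @ B @ f # M) (L @ ?B @ f # M)"
    if "set (L @ B @ f # M) \<subseteq> carrier G" for L M
  proof (rule hurwitz_equiv_trans)
    show "hurwitz_equiv G (L @ B @ f # M) (L @ f # ?B @ M)"
      using that by (rule hurwitz_equiv_move_right_conj_by)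
    show "hurwitz_equiv G (L @ f # ?B @ M) (L @ ?B @ f # M)"
      using that B by (intro hurwitz_equiv_move_left) auto
  qed (use that in auto)
  \<comment> \<open>When \<open>f\<close> is further to the right, the block is carried up to it,
    conjugated there and carried back.\<close>
  have **: "hurwitz_equiv G (L @ B @ M) (L @ ?B @ M)"
    if LM: "set (L @ B @ M) \<subseteq> carrier G" and "f \<in> set M" for L M
  proof -
    obtain M1 M2 where M: "M = M1 @ f # M2" using \<open>f \<in> set M\<close> by (meson split_list)
    have "hurwitz_equiv G (L @ M1 @ B @ f # M2) (L @ B @ M1 @ f # M2)"
      using LM assms(2) by (intro hurwitz_equiv_move_left_list) (auto simp: M)
    then have 1: "hurwitz_equiv G (L @ B @ M) (L @ M1 @ B @ f # M2)"
      unfolding M by (rule hurwitz_equiv_sym) (use LM M in auto)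
    have 2: "hurwitz_equiv G (L @ M1 @ B @ f # M2) (L @ M1 @ ?B @ f # M2)"
      using * [of "L @ M1" M2] LM by (simp add: M)
    have 3: "hurwitz_equiv G (L @ M1 @ ?B @ f # M2) (L @ ?B @ M)"
      using hurwitz_equiv_move_left_list [of L M1 ?B "f # M2"] LM B by (auto simp: M)
    show ?thesis
      by (rule hurwitz_equiv_trans [OF hurwitz_equiv_trans [OF 1 2 LM] 3 LM])
  qed
  show ?thesis
  proof (cases "f \<in> set Q")
    case True
    with ** assms(1) show ?thesis by blast
  next
    \<comment> \<open>When \<open>f\<close> occurs only in \<open>P\<close>, the block first goes to
      the front of the tuple, which puts \<open>f\<close> on its right.\<close>
    case False
    with assms(3) have fP: "f \<in> set (P @ Q)" "set ([] @ B @ P @ Q) \<subseteq> carrier G"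
      using assms(1) by auto
    have 1: "hurwitz_equiv G (P @ B @ Q) (B @ P @ Q)"
      using hurwitz_equiv_move_left_list [of "[]" P B Q] assms by auto
    have 2: "hurwitz_equiv G (B @ P @ Q) (?B @ P @ Q)"
      using ** [of "[]" "P @ Q"] fP by auto
    have "hurwitz_equiv G (P @ ?B @ Q) (?B @ P @ Q)"
      using hurwitz_equiv_move_left_list [of "[]" P ?B Q] assms B by simp
    then have 3: "hurwitz_equiv G (?B @ P @ Q) (P @ ?B @ Q)"
      by (rule hurwitz_equiv_sym) (use assms B in simp_all)
    show ?thesis
      by (rule hurwitz_equiv_trans [OF hurwitz_equiv_trans [OF 1 2 assms(1)] 3 assms(1)])
  qed
qed

text \<open>Single conjugations compose because a conjugated block still has product 1 and the other
  entries are untouched. For an inverse, the move is applied to the block already conjugated by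
  \<open>inv h\<close> and then reversed.\<close>

lemma hurwitz_equiv_conj_by_generate:
  assumes "g \<in> generate G (set (P @ Q))"
    and "set (P @ B @ Q) \<subseteq> carrier G" "list_prod G B = \<one>"
  shows "hurwitz_equiv G (P @ B @ Q) (P @ map (\<lambda>x. conj_by G x g) B @ Q)"
  using assms
proof (induction g arbitrary: B rule: generate.induct)
  case one
  have "map (\<lambda>x. conj_by G x \<one>) B = B"
    using one by (intro map_idI) auto
  then show ?case by (simp add: hurwitz_equiv_refl)
next
  case (incl h)
  then show ?case by (intro hurwitz_equiv_conj_by_mem)
next
  case (inv h)
  let ?B = "map (\<lambda>x. conj_by G x (inv h)) B"
  have h: "h \<in> carrier G" using inv by auto
  then have "set (P @ ?B @ Q) \<subseteq> carrier G" "list_prod G ?B = \<one>"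
    using inv by (auto simp: list_prod_map_conj_by)
  then have "hurwitz_equiv G (P @ ?B @ Q) (P @ map (\<lambda>x. conj_by G x h) ?B @ Q)"
    using inv.hyps by (intro hurwitz_equiv_conj_by_mem)
  moreover have "map (\<lambda>x. conj_by G x h) ?B = B"
    using inv.prems h by (auto simp: comp_def intro!: map_idI)
  ultimately have "hurwitz_equiv G (P @ ?B @ Q) (P @ B @ Q)"
    by (simp only:)
  then show ?case
    using \<open>set (P @ ?B @ Q) \<subseteq> carrier G\<close> by (rule hurwitz_equiv_sym)
next
  case (eng g h)
  let ?B = "map (\<lambda>x. conj_by G x g) B"
  have gh: "g \<in> carrier G" "h \<in> carrier G"
    using eng.hyps eng.prems generate_in_carrier [of "set (P @ Q)"] by auto
  then have "set (P @ ?B @ Q) \<subseteq> carrier G" "list_prod G ?B = \<one>"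
    using eng.prems by (auto simp: list_prod_map_conj_by)
  then have "hurwitz_equiv G (P @ ?B @ Q) (P @ map (\<lambda>x. conj_by G x h) ?B @ Q)"
    by (rule eng.IH)
  moreover have "map (\<lambda>x. conj_by G x h) ?B = map (\<lambda>x. conj_by G x (g \<otimes> h)) B"
    using eng.prems(1) gh by (simp add: conj_by_mult_right subset_iff)
  ultimately have "hurwitz_equiv G (P @ ?B @ Q) (P @ map (\<lambda>x. conj_by G x (g \<otimes> h)) B @ Q)"
    by (simp only:)
  with eng.IH(1) [OF eng.prems] show ?case
    using eng.prems(1) by (rule hurwitz_equiv_trans)
qed

end

section \<open>Transport of Hurwitz equivalence along homomorphisms\<close>

context group_hom
begin

lemma hom_conj_by:
  "x \<in> carrier G \<Longrightarrow> g \<in> carrier G \<Longrightarrow> h (conj_by G x g) = conj_by H (h x) (h g)"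
  by (simp add: conj_by_def)

lemma hurwitz_equiv_map:
  assumes "hurwitz_equiv G fs gs" "set fs \<subseteq> carrier G"
  shows "hurwitz_equiv H (map h fs) (map h gs)"
  using assms
proof (induction rule: G.hurwitz_equiv_induct)
  case refl
  show ?case by (rule H.hurwitz_equiv_refl)
next
  case (sigma P x y Q)
  have "hurwitz_equiv H (map h (P @ x # y # Q)) (map h (P @ y # conj_by G x y # Q))"
    using sigma(1) H.hurwitz_equiv_sigma [of "map h P" "h x" "h y" "map h Q"]
    by (simp add: hom_conj_by)
  with sigma(2) show ?case
    by (rule H.hurwitz_equiv_trans) (use assms(2) in auto)
next
  case (sigma_inv P x y Q)
  have "hurwitz_equiv H (map h (P @ x # y # Q)) (map h (P @ conj_by G y (inv\<^bsub>G\<^esub> x) # x # Q))"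
    using sigma_inv(1) H.hurwitz_equiv_sigma_inv [of "h x" "map h P" "h y" "map h Q"]
    by (simp add: hom_conj_by)
  with sigma_inv(2) show ?case
    by (rule H.hurwitz_equiv_trans) (use assms(2) in auto)
qed

text \<open>Each move on the image tuple is the image of the same move on the original tuple, so
  whole paths lift.\<close>

lemma hurwitz_equiv_map_lift:
  assumes "hurwitz_equiv H (map h fs) ls" "set fs \<subseteq> carrier G"
  shows "\<exists>gs. ls = map h gs \<and> hurwitz_equiv G fs gs"
proof -
  have "set (map h fs) \<subseteq> carrier H" using assms(2) by auto
  with assms(1) show ?thesis
  proof (induction rule: H.hurwitz_equiv_induct)
    case refl
    show ?case using G.hurwitz_equiv_refl by blast
  next
    case (sigma P' x' y' Q')
    then obtain P x y Q where eq: "P' = map h P" "x' = h x" "y' = h y" "Q' = map h Q"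
      and gs: "hurwitz_equiv G fs (P @ x # y # Q)"
      by (auto simp: append_eq_map_conv Cons_eq_map_conv)
    have "set (P @ x # y # Q) \<subseteq> carrier G"
      using G.hurwitz_equiv_closed(1) [OF gs assms(2)] .
    then show ?case
      using G.hurwitz_equiv_trans [OF gs G.hurwitz_equiv_sigma assms(2)]
      by (intro exI [of _ "P @ y # conj_by G x y # Q"]) (simp add: eq hom_conj_by)
  next
    case (sigma_inv P' x' y' Q')
    then obtain P x y Q where eq: "P' = map h P" "x' = h x" "y' = h y" "Q' = map h Q"
      and gs: "hurwitz_equiv G fs (P @ x # y # Q)"
      by (auto simp: append_eq_map_conv Cons_eq_map_conv)
    have x: "set (P @ x # y # Q) \<subseteq> carrier G"
      using G.hurwitz_equiv_closed(1) [OF gs assms(2)] .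
    then show ?case
      using G.hurwitz_equiv_trans [OF gs G.hurwitz_equiv_sigma_inv assms(2)]
      by (intro exI [of _ "P @ conj_by G y (inv\<^bsub>G\<^esub> x) # x # Q"]) (simp add: eq hom_conj_by)
  qed
qed

text \<open>A lifted path ends at a tuple with the same image as \<open>gs\<close>, and injectivity
  identifies the two. This removes the embedding \<open>\<iota>\<close> from the problem.\<close>

lemma hurwitz_equiv_map_iff:
  assumes "inj_on h (carrier G)" "set fs \<subseteq> carrier G" "set gs \<subseteq> carrier G"
  shows "hurwitz_equiv H (map h fs) (map h gs) \<longleftrightarrow> hurwitz_equiv G fs gs"
proof
  assume "hurwitz_equiv H (map h fs) (map h gs)"
  then obtain gs' where gs': "map h gs = map h gs'" "hurwitz_equiv G fs gs'"
    using hurwitz_equiv_map_lift assms(2) by blast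
  have "set gs' \<subseteq> carrier G" using gs'(2) assms(2) by (rule G.hurwitz_equiv_closed)
  then have "gs = gs'"
    using gs'(1) assms by (metis inj_on_map_eq_map inj_on_subset le_sup_iff)
  with gs'(2) show "hurwitz_equiv G fs gs" by simp
qed (use assms hurwitz_equiv_map in blast)

end

section \<open>Roots and centralizers in free groups\<close>

context group
begin

lemma int_pow_conj_by:
  fixes k :: int
  assumes "x \<in> carrier G" "g \<in> carrier G"
  shows "conj_by G (x [^] k) g = conj_by G x g [^] k"
proof -
  have "(\<lambda>x. conj_by G x g) \<in> hom G G"
    using assms(2) by (auto simp: hom_def conj_by_mult_left)
  then interpret group_hom G G "\<lambda>x. conj_by G x g"
    by unfold_locales
  show ?thesis using assms(1) by (rule hom_int_pow)
qed

text \<open>The exponent 0 is allowed for a root, so a rootless element is nontrivial.\<close>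

lemma has_root_one: "has_root G \<one>"
  unfolding has_root_def by (rule bexI [of _ \<one>], rule exI [of _ 0]) auto

lemma has_root_conj_by:
  assumes "has_root G (conj_by G x g)" "x \<in> carrier G" "g \<in> carrier G"
  shows "has_root G x"
proof -
  obtain w and k :: int where w: "w \<in> carrier G" "k \<noteq> 1" "k \<noteq> -1" "conj_by G x g = w [^] k"
    using assms(1) by (auto simp: has_root_def)
  have "x = conj_by G w (inv g) [^] k"
    using assms w(1) by (simp flip: int_pow_conj_by w(4))
  with w assms(3) show ?thesis unfolding has_root_def by (metis conj_by_closed inv_closed)
qed

lemma has_root_inv:
  assumes "has_root G (inv x)" "x \<in> carrier G"
  shows "has_root G x"
proof -
  obtain w and k :: int where w: "w \<in> carrier G" "k \<noteq> 1" "k \<noteq> -1" "inv x = w [^] k"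
    using assms(1) by (auto simp: has_root_def)
  have "x = w [^] (- k)"
    using assms(2) w(1) by (simp add: int_pow_neg flip: w(4))
  with w show ?thesis
    unfolding has_root_def by (metis minus_equation_iff)
qed

end

section \<open>Reduced words, lengths and powers\<close>

lemma carrier_free_group: "w \<in> carrier (free_group A) \<longleftrightarrow> reduced w \<and> fst ` set w \<subseteq> A"
  by (simp add: free_group_def)

lemma one_free_group: "\<one>\<^bsub>free_group A\<^esub> = []"
  by (simp add: free_group_def)

lemma mult_free_group: "u \<otimes>\<^bsub>free_group A\<^esub> v = reduce (u @ v)"
  by (simp add: free_group_def)

lemma reduce_Nil [simp]: "reduce [] = []"
  by (simp add: reduce_def)

lemma reduce_Cons: "reduce (x # w) = cancel_Cons x (reduce w)"
  by (simp add: reduce_def)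

lemma reduced_append:
  "reduced (u @ v) \<longleftrightarrow>
    reduced u \<and> reduced v \<and> (u = [] \<or> v = [] \<or> hd v \<noteq> letter_inv (last u))"
  by (auto simp: reduced_def successively_append_iff)

lemma letter_inv_eq_iff: "letter_inv x = y \<longleftrightarrow> x = letter_inv y"
  by auto

lemma reduced_rev_map_letter_inv: "reduced w \<Longrightarrow> reduced (rev (map letter_inv w))"
  by (induction w) (auto simp: reduced_append reduced_Cons last_rev hd_map)

lemma inv_free_group:
  assumes "w \<in> carrier (free_group A)"
  shows "inv\<^bsub>free_group A\<^esub> w = rev (map letter_inv w)"
proof -
  interpret F: group "free_group A" by (rule group_free_group)
  show ?thesis
  proof (rule F.inv_equality)
    show "rev (map letter_inv w) \<otimes>\<^bsub>free_group A\<^esub> w = \<one>\<^bsub>free_group A\<^esub>"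
      by (simp add: mult_free_group one_free_group reduce_letter_inv_append)
    show "rev (map letter_inv w) \<in> carrier (free_group A)"
      using assms by (auto simp: carrier_free_group reduced_rev_map_letter_inv)
  qed (rule assms)
qed

lemma length_cancel_Cons_le: "length (cancel_Cons x w) \<le> Suc (length w)"
  by (cases w) auto

lemma length_reduce_le: "length (reduce w) \<le> length w"
proof (induction w)
  case (Cons x w)
  then show ?case
    using length_cancel_Cons_le [of x "reduce w"] by (simp add: reduce_Cons)
qed simp

text \<open>Every cancellation shortens the word, so an unchanged length means that none took
  place.\<close>

lemma reduced_if_length_reduce_eq: "length (reduce w) = length w \<Longrightarrow> reduced w"
proof (induction w)
  case (Cons x w)
  have "length (reduce w) = length w"
    using Cons.prems length_cancel_Cons_le [of x "reduce w"] length_reduce_le [of w]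
    by (simp add: reduce_Cons)
  then have "reduced w" by (rule Cons.IH)
  moreover from this have "length (cancel_Cons x w) = Suc (length w)"
    using Cons.prems by (simp add: reduce_Cons reduce_reduced)
  ultimately show ?case
    by (cases w) (auto simp: reduced_Cons split: if_splits)
qed simp

lemma nat_pow_free_group:
  "reduced w \<Longrightarrow> w [^]\<^bsub>free_group A\<^esub> (m :: nat) = reduce (concat (replicate m w))"
proof (induction m)
  case 0
  then show ?case by (simp add: one_free_group)
next
  case (Suc m)
  have "concat (replicate (Suc m) w) = concat (replicate m w) @ w"
    by (simp flip: replicate_append_same)
  with Suc show ?case
    by (simp add: mult_free_group reduce_append_left)
qed

text \<open>The word \<open>g @ h\<close> reduces to \<open>h @ g\<close>, which has the same
  length, so the two words are equal. Commuting words are powers of a common word, and rootlessness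
  of \<open>h\<close> makes that word \<open>h\<close> itself.\<close>

lemma commute_imp_power_if_reduced:
  assumes h: "h \<in> carrier (free_group A)" "\<not> has_root (free_group A) h"
    and g: "g \<in> carrier (free_group A)"
    and comm: "h \<otimes>\<^bsub>free_group A\<^esub> g = g \<otimes>\<^bsub>free_group A\<^esub> h"
    and hg: "reduced (h @ g)"
  shows "\<exists>k::int. g = h [^]\<^bsub>free_group A\<^esub> k"
proof -
  interpret F: group "free_group A" by (rule group_free_group)
  have "h \<noteq> []"
    using h(2) F.has_root_one by (auto simp: one_free_group)
  have eq: "reduce (g @ h) = h @ g"
    using comm hg by (simp add: mult_free_group reduce_reduced)
  then have "reduced (g @ h)"
    by (intro reduced_if_length_reduce_eq) simp
  then have "g @ h = h @ g" using eq by (simp add: reduce_reduced)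
  then obtain m l zs where z: "concat (replicate m zs) = h" "concat (replicate l zs) = g"
    using comm_append_are_replicate [of h g] by metis
  \<comment> \<open>With a positive exponent \<open>zs\<close> is a prefix of \<open>h\<close>,
    hence reduced and an element of the free group.\<close>
  have "m \<noteq> 0" using z(1) \<open>h \<noteq> []\<close> by (intro notI) simp
  then obtain m' where "m = Suc m'" by (cases m) auto
  then have "h = zs @ concat (replicate m' zs)" using z(1) by simp
  then have zs: "reduced zs" "zs \<in> carrier (free_group A)"
    using h(1) by (auto simp: carrier_free_group reduced_append)
  have pow: "h = zs [^]\<^bsub>free_group A\<^esub> int m" "g = zs [^]\<^bsub>free_group A\<^esub> int l"
    using h(1) g zs(1) z by (simp_all add: int_pow_int nat_pow_free_group reduce_reduced carrier_free_group)
  \<comment> \<open>Rootlessness leaves the exponents 1 and -1, and \<open>m\<close> is a natural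
    number.\<close>
  then have "int m = 1"
    using h(2) zs(2) unfolding has_root_def by (metis of_nat_0_le_iff neg_0_le_iff_le not_one_le_zero)
  then show ?thesis using pow zs(2) by (metis F.int_pow_1)
qed

text \<open>Conjugation reduces to cyclically reduced \<open>h\<close>. Then at least one of \<open>h g\<close> and \<open>h\<^sup>-\<^sup>1 g\<close> is
  free of cancellation, so that \<open>h\<close> or its inverse commutes with \<open>g\<close> already as a word.\<close>

theorem free_group_commute_imp_power:
  assumes "h \<in> carrier (free_group A)" "\<not> has_root (free_group A) h"
    and "g \<in> carrier (free_group A)"
    and "h \<otimes>\<^bsub>free_group A\<^esub> g = g \<otimes>\<^bsub>free_group A\<^esub> h"
  shows "\<exists>k::int. g = h [^]\<^bsub>free_group A\<^esub> k"
  using assms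
proof (induction "length h" arbitrary: h g rule: less_induct)
  case less
  interpret F: group "free_group A" by (rule group_free_group)
  note h = less.prems(1) and g = less.prems(3)
  have "h \<noteq> []"
    using less.prems(2) F.has_root_one by (auto simp: one_free_group)
  show ?case
  proof (cases "hd h = letter_inv (last h)")
    case True
    \<comment> \<open>No letter is its own inverse, so the two ends of \<open>h\<close> are distinct
      positions. Peeling them off is conjugation by \<open>[x]\<close> and leaves the shorter word
      \<open>u\<close>, to which the induction applies.\<close>
    then have "length h \<noteq> 1"
      using letter_inv_neq(2) [of "hd h"] by (cases h) auto
    with \<open>h \<noteq> []\<close> obtain x t where "h = x # t" "t \<noteq> []"
      by (cases h) auto
    then obtain u where hu: "h = x # u @ [letter_inv x]"
      using True by (cases t rule: rev_cases) (auto simp: letter_inv_eq_iff)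
    then have u: "u \<in> carrier (free_group A)" and x: "[x] \<in> carrier (free_group A)"
      and xu: "reduced (x # u)"
      using h by (auto simp: carrier_free_group reduced_append reduced_Cons)
    have "conj_by (free_group A) h [x] = reduce ([letter_inv x, x] @ u @ [letter_inv x, x])"
      using x by (simp add: conj_by_def inv_free_group mult_free_group reduce_append_left hu)
    also have "\<dots> = u"
    proof -
      have "reduce ([letter_inv x, x] @ u @ [letter_inv x, x])
          = cancel_Cons (letter_inv x) (cancel_Cons x (reduce (u @ [letter_inv x, x])))"
        by (simp add: reduce_Cons)
      also have "\<dots> = reduce (u @ [letter_inv x, x])"
        by (simp add: cancel_Cons_letter_inv' reduced_reduce)
      also have "\<dots> = reduce (u @ reduce [letter_inv x, x])"
        by (simp only: reduce_append_right)
      also have "\<dots> = u"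
        using u by (simp add: reduce_Cons reduce_reduced carrier_free_group)
      finally show ?thesis .
    qed
    finally have hx: "conj_by (free_group A) h [x] = u" .
    have "\<exists>k::int. conj_by (free_group A) g [x] = u [^]\<^bsub>free_group A\<^esub> k"
    proof (rule less.hyps)
      show "\<not> has_root (free_group A) u"
        using less.prems(2) F.has_root_conj_by [OF _ h x] hx by auto
      show "u \<otimes>\<^bsub>free_group A\<^esub> conj_by (free_group A) g [x]
          = conj_by (free_group A) g [x] \<otimes>\<^bsub>free_group A\<^esub> u"
        using h g x less.prems(4) by (simp flip: hx F.conj_by_mult_left)
    qed (use u g x hu in auto)
    then obtain k :: int where "conj_by (free_group A) g [x] = conj_by (free_group A) (h [^]\<^bsub>free_group A\<^esub> k) [x]"
      using h x by (auto simp: F.int_pow_conj_by hx)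
    then have "g = h [^]\<^bsub>free_group A\<^esub> k"
      using h g x F.conj_by_conj_by_inv(1) F.int_pow_closed by metis
    then show ?thesis by blast
  next
    case cyc: False
    show ?thesis
    proof (cases "g = [] \<or> hd g \<noteq> letter_inv (last h)")
      case True
      then have "reduced (h @ g)"
        using h g by (auto simp: reduced_append carrier_free_group)
      then show ?thesis using less.prems commute_imp_power_if_reduced by blast
    next
      case False
      let ?h = "inv\<^bsub>free_group A\<^esub> h"
      have "last ?h = letter_inv (hd h)"
        using h \<open>h \<noteq> []\<close> by (simp add: inv_free_group last_rev hd_map)
      \<comment> \<open>Here \<open>hd g\<close> is the inverse of \<open>last h\<close>.
        Cancellation between \<open>?h\<close> and \<open>g\<close> would make it equal to
        \<open>hd h\<close> too, against cyclic reducedness.\<close>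
      then have "reduced (?h @ g)"
        using False cyc g F.inv_closed [OF h] by (auto simp: reduced_append carrier_free_group)
      moreover have "?h \<otimes>\<^bsub>free_group A\<^esub> g = g \<otimes>\<^bsub>free_group A\<^esub> ?h"
        using h g less.prems(4) by (metis F.inv_closed F.inv_solve_left F.inv_solve_right F.m_assoc F.m_closed)
      moreover have "\<not> has_root (free_group A) ?h"
        using less.prems(2) F.has_root_inv h by blast
      ultimately obtain k :: int where "g = ?h [^]\<^bsub>free_group A\<^esub> k"
        using h g commute_imp_power_if_reduced by blast
      then have "g = h [^]\<^bsub>free_group A\<^esub> (- k)"
        using h by (simp add: F.int_pow_neg F.int_pow_inv)
      then show ?thesis by blast
    qed
  qed
qed

section \<open>Exponent sums and retractions\<close>

text \<open>Defined on unreduced words as well, so that invariance under cancellation yields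
  additivity on the free group.\<close>

definition exponent_sum :: "'a \<Rightarrow> 'a word \<Rightarrow> int" where
  "exponent_sum x w = (\<Sum>(y, s)\<leftarrow>w. if y = x then if s then 1 else - 1 else 0)"

lemma exponent_sum_Nil [simp]: "exponent_sum x [] = 0"
  by (simp add: exponent_sum_def)

lemma exponent_sum_append [simp]:
  "exponent_sum x (u @ v) = exponent_sum x u + exponent_sum x v"
  by (simp add: exponent_sum_def)

lemma exponent_sum_reduce [simp]: "exponent_sum x (reduce w) = exponent_sum x w"
proof (induction w)
  case (Cons y w)
  have "exponent_sum x (cancel_Cons y u) = exponent_sum x (y # u)" for u
    by (cases u) (auto simp: exponent_sum_def letter_inv_def split: prod.splits)
  with Cons show ?case by (simp add: reduce_Cons) (simp add: exponent_sum_def)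
qed simp

lemma exponent_sum_mult [simp]:
  "exponent_sum x (u \<otimes>\<^bsub>free_group A\<^esub> v) = exponent_sum x u + exponent_sum x v"
  by (simp add: mult_free_group)

lemma exponent_sum_inv [simp]:
  assumes "w \<in> carrier (free_group A)"
  shows "exponent_sum x (inv\<^bsub>free_group A\<^esub> w) = - exponent_sum x w"
proof -
  interpret F: group "free_group A" by (rule group_free_group)
  have "exponent_sum x (inv\<^bsub>free_group A\<^esub> w \<otimes>\<^bsub>free_group A\<^esub> w) = 0"
    using assms by (simp only: F.l_inv) (simp add: one_free_group)
  then show ?thesis by simp
qed

lemma exponent_sum_conj_by [simp]:
  "g \<in> carrier (free_group A) \<Longrightarrow> exponent_sum x (conj_by (free_group A) w g) = exponent_sum x w"
  by (simp add: conj_by_def)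

lemma exponent_sum_nat_pow:
  "exponent_sum x (w [^]\<^bsub>free_group A\<^esub> (k::nat)) = int k * exponent_sum x w"
  by (induction k) (simp_all add: one_free_group algebra_simps)

lemma exponent_sum_int_pow:
  fixes k :: int
  assumes "w \<in> carrier (free_group A)"
  shows "exponent_sum x (w [^]\<^bsub>free_group A\<^esub> k) = k * exponent_sum x w"
proof -
  interpret F: group "free_group A" by (rule group_free_group)
  show ?thesis
  proof (cases k rule: int_cases2)
    case (nonneg m)
    then show ?thesis by (simp only: int_pow_int exponent_sum_nat_pow)
  next
    case (nonpos m)
    then show ?thesis
      using assms F.nat_pow_closed [OF assms, of m]
      by (simp only: F.int_pow_neg int_pow_int exponent_sum_nat_pow exponent_sum_inv)
  qed
qed

lemma exponent_sum_gen: "exponent_sum x (gen y) = (if x = y then 1 else 0)"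
  by (simp add: exponent_sum_def gen_def)

lemma gen_closed [simp]: "gen x \<in> carrier (free_group A) \<longleftrightarrow> x \<in> A"
  by (auto simp: carrier_free_group gen_def reduced_Cons)

text \<open>The exponent sum of a \<open>k\<close>-th power is a multiple of \<open>k\<close>,
  whereas that of a generator is 1.\<close>

lemma not_has_root_gen: "\<not> has_root (free_group A) (gen x)"
proof
  assume "has_root (free_group A) (gen x)"
  then obtain w and k :: int where w: "w \<in> carrier (free_group A)" "k \<noteq> 1" "k \<noteq> -1"
      "gen x = w [^]\<^bsub>free_group A\<^esub> k"
    by (auto simp: has_root_def)
  have "k * exponent_sum x w = 1"
    using exponent_sum_int_pow [OF w(1), of x k] by (simp add: exponent_sum_gen flip: w(4))
  with w(2,3) show False by (simp add: zmult_eq_1_iff)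
qed

text \<open>The homomorphism that sends generators outside \<open>B\<close> to 1 and fixes the
  others. Deleting letters can create new cancellations, hence the reduction.\<close>

definition retract :: "'a set \<Rightarrow> 'a word \<Rightarrow> 'a word" where
  "retract B w = reduce (filter (\<lambda>y. fst y \<in> B) w)"

text \<open>Two cancelling letters belong to the same generator, so the filter keeps both or drops
  both.\<close>

lemma reduce_filter_reduce:
  "reduce (filter (\<lambda>y. fst y \<in> B) (reduce w)) = reduce (filter (\<lambda>y. fst y \<in> B) w)"
proof (induction w)
  case (Cons x w)
  have "reduce (filter (\<lambda>y. fst y \<in> B) (cancel_Cons x u)) = reduce (filter (\<lambda>y. fst y \<in> B) (x # u))" for u
    by (cases u) (auto simp: reduce_Cons cancel_Cons_letter_inv reduced_reduce)
  with Cons show ?case by (simp add: reduce_Cons)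
qed simp

lemma retract_hom: "retract B \<in> hom (free_group A) (free_group B)"
proof (rule homI)
  fix u
  have "set (retract B u) \<subseteq> set (filter (\<lambda>y. fst y \<in> B) u)"
    unfolding retract_def by (rule set_reduce)
  then have "fst ` set (retract B u) \<subseteq> B"
    by fastforce
  then show "retract B u \<in> carrier (free_group B)"
    by (simp add: carrier_free_group retract_def reduced_reduce)
next
  fix u v
  show "retract B (u \<otimes>\<^bsub>free_group A\<^esub> v) = retract B u \<otimes>\<^bsub>free_group B\<^esub> retract B v"
    by (simp add: retract_def mult_free_group reduce_filter_reduce reduce_append_left reduce_append_right)
qed

lemma retract_gen: "retract B (gen x) = (if x \<in> B then gen x else [])"
  by (simp add: retract_def gen_def reduce_Cons)

lemma retract_id: "w \<in> carrier (free_group B) \<Longrightarrow> retract B w = w"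
proof -
  assume w: "w \<in> carrier (free_group B)"
  then have "filter (\<lambda>y. fst y \<in> B) w = w"
    by (intro filter_True) (auto simp: carrier_free_group)
  with w show ?thesis by (simp add: retract_def carrier_free_group reduce_reduced)
qed

section \<open>Normal closures and products\<close>

context group
begin

lemma normal_closure_normal:
  assumes "S \<subseteq> carrier G"
  shows "normal_closure G S \<lhd> G"
proof -
  let ?\<N> = "{N. N \<lhd> G \<and> S \<subseteq> N}"
  \<comment> \<open>The family must be nonempty: an empty intersection would be the whole type
    instead of a subgroup.\<close>
  have "carrier G \<lhd> G"
    by (simp add: normal_inv_iff subgroup_self)
  then have ne: "?\<N> \<noteq> {}" using assms by blast
  have "subgroup (\<Inter>?\<N>) G"
    by (rule subgroups_Inter) (use ne in \<open>auto simp: normal_imp_subgroup\<close>)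
  moreover have "x \<otimes> h \<otimes> inv x \<in> \<Inter>?\<N>" if "x \<in> carrier G" "h \<in> \<Inter>?\<N>" for x h
    using that by (auto simp: normal_inv_iff)
  ultimately show ?thesis
    by (simp add: normal_closure_def normal_inv_iff)
qed

lemma normal_closure_incl: "S \<subseteq> normal_closure G S"
  by (auto simp: normal_closure_def)

lemma normal_closure_least: "N \<lhd> G \<Longrightarrow> S \<subseteq> N \<Longrightarrow> normal_closure G S \<subseteq> N"
  by (auto simp: normal_closure_def)

text \<open>Supplies the invariant subgroup of pairs whose components agree modulo
  \<open>N\<close>.\<close>

lemma subgroup_equalizer:
  assumes "f \<in> hom G H" "f' \<in> hom G H" "group H"
  shows "subgroup {x \<in> carrier G. f x = f' x} G"
proof -
  interpret f: group_hom G H f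
    using assms by (simp add: group_hom_def group_hom_axioms_def is_group)
  interpret f': group_hom G H f'
    using assms by (simp add: group_hom_def group_hom_axioms_def is_group)
  show ?thesis
    by (rule subgroupI) auto
qed

lemma list_prod_in_subgroup: "subgroup K G \<Longrightarrow> set xs \<subseteq> K \<Longrightarrow> list_prod G xs \<in> K"
  by (induction xs) (auto simp: list_prod_def subgroup.one_closed subgroup.m_closed)

lemma close_up_in_subgroup: "subgroup K G \<Longrightarrow> set xs \<subseteq> K \<Longrightarrow> set (close_up G xs) \<subseteq> K"
  by (auto simp: close_up_def list_prod_in_subgroup subgroup.m_inv_closed)

end

lemma conj_by_DirProd:
  assumes "group G" "group H" "h \<in> carrier G" "h' \<in> carrier H"
  shows "conj_by (G \<times>\<times> H) (g, g') (h, h') = (conj_by G g h, conj_by H g' h')"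
  using assms by (simp add: conj_by_def)

lemma list_prod_DirProd_one_right:
  assumes "monoid H"
  shows "list_prod (G \<times>\<times> H) (map (\<lambda>x. (x, \<one>\<^bsub>H\<^esub>)) xs) = (list_prod G xs, \<one>\<^bsub>H\<^esub>)"
  using assms by (induction xs) (auto simp: list_prod_def monoid.l_one)

section \<open>The tuples before embedding\<close>

text \<open>Otherwise the simplifier turns \<open>{1..n}\<close> into \<open>{Suc 0..n}\<close>, and rules about \<open>Fr n\<close> no longer apply.\<close>

declare One_nat_def [simp del]

abbreviation (input) FrP :: "nat \<Rightarrow> (nat word \<times> nat word) monoid" where
  "FrP n \<equiv> Fr n \<times>\<times> Fr (n + 1)"

lemma group_FrP: "group (FrP n)"
  by (intro DirProd_group group_free_group)

lemma inv_FrP: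
  "u \<in> carrier (Fr n) \<Longrightarrow> w \<in> carrier (Fr (n + 1)) \<Longrightarrow>
    inv\<^bsub>FrP n\<^esub> (u, w) = (inv\<^bsub>Fr n\<^esub> u, inv\<^bsub>Fr (n + 1)\<^esub> w)"
  by (rule inv_DirProd) (rule group_free_group)+

definition R_block :: "nat \<Rightarrow> nat word list \<Rightarrow> (nat word \<times> nat word) list" where
  "R_block n V = map (\<lambda>r. (r, \<one>\<^bsub>Fr (n + 1)\<^esub>)) (close_up (Fr n) V)"

text \<open>The generators z_i and X_i are both the word \<open>gen i\<close>, so these entries lie
  on the diagonal.\<close>

definition W_block :: "nat \<Rightarrow> (nat word \<times> nat word) list" where
  "W_block n = map (\<lambda>w. (w, w)) (close_up (Fr n) (gens n))"

text \<open>Writing the first entry as the inverse of the second makes the trivial product evident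
  and shows that conjugation preserves the shape of the block.\<close>

definition H_block :: "nat \<Rightarrow> nat word \<Rightarrow> (nat word \<times> nat word) list" where
  "H_block n c = [inv\<^bsub>FrP n\<^esub> (c, gen (n + 1)), (c, gen (n + 1))]"

definition FTL_tuple :: "nat \<Rightarrow> nat word list \<Rightarrow> nat word \<Rightarrow> (nat word \<times> nat word) list" where
  "FTL_tuple n V c = R_block n V @ W_block n @ H_block n c"

lemma set_gens: "set (gens n) = gen ` {1..n}"
  by (auto simp: gens_def)

lemma gens_closed: "set (gens n) \<subseteq> carrier (Fr n)"
  by (auto simp: set_gens)

lemma free_group_mono: "A \<subseteq> B \<Longrightarrow> carrier (free_group A) \<subseteq> carrier (free_group B)"
  unfolding carrier_free_group subset_iff by blast

text \<open>Multiplication of words ignores the alphabet, and inverses are given by the same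
  explicit word. Consequently the W-part and the X-part of the tuple close up to the same
  list.\<close>

lemma close_up_free_group_mono:
  assumes "set xs \<subseteq> carrier (free_group A)" "A \<subseteq> B"
  shows "close_up (free_group B) xs = close_up (free_group A) xs"
proof -
  have eq: "list_prod (free_group B) xs = list_prod (free_group A) xs"
    by (simp add: list_prod_def free_group_def)
  have "list_prod (free_group A) xs \<in> carrier (free_group A)"
    using group.list_prod_closed [OF group_free_group assms(1)] .
  then show ?thesis
    using free_group_mono [OF assms(2)] by (auto simp: close_up_def eq inv_free_group)
qed

lemma FTL_s1_eq:
  assumes "c \<in> carrier (Fr n)"
  shows "FTL_s1 \<iota> n V c = map \<iota> (FTL_tuple n V c)"
proof -
  have W: "close_up (Fr (n + 1)) (gens n) = close_up (Fr n) (gens n)"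
    by (rule close_up_free_group_mono [OF gens_closed]) auto
  show ?thesis
    using assms
    by (simp add: inv_FrP FTL_s1_def P_tuple_def W FTL_tuple_def R_block_def W_block_def H_block_def
        nth_append zip_same_conv_map)
qed

lemma R_block_closed:
  assumes "set V \<subseteq> carrier (Fr n)"
  shows "set (R_block n V) \<subseteq> carrier (FrP n)"
  using group.set_close_up [OF group_free_group assms]
  by (auto simp: R_block_def group.is_monoid [OF group_free_group])

lemma W_block_closed: "set (W_block n) \<subseteq> carrier (FrP n)"
  using group.set_close_up [OF group_free_group gens_closed [of n]]
    free_group_mono [of "{1..n}" "{1..n + 1}"]
  by (auto simp: W_block_def)

lemma H_block_closed: "c \<in> carrier (Fr n) \<Longrightarrow> set (H_block n c) \<subseteq> carrier (FrP n)"
  using group.inv_closed [OF group_FrP, of "(c, gen (n + 1))" n] by (simp add: H_block_def)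

lemma FTL_tuple_closed:
  "set V \<subseteq> carrier (Fr n) \<Longrightarrow> c \<in> carrier (Fr n) \<Longrightarrow> set (FTL_tuple n V c) \<subseteq> carrier (FrP n)"
  using R_block_closed [of V n] W_block_closed [of n] H_block_closed [of c n]
  by (simp add: FTL_tuple_def)

lemma list_prod_R_block:
  assumes "set V \<subseteq> carrier (Fr n)"
  shows "list_prod (FrP n) (R_block n V) = \<one>\<^bsub>FrP n\<^esub>"
  unfolding R_block_def
  by (simp add: list_prod_DirProd_one_right group.is_monoid group_free_group
      group.list_prod_close_up assms)

lemma list_prod_H_block:
  assumes "c \<in> carrier (Fr n)"
  shows "list_prod (FrP n) (H_block n c) = \<one>\<^bsub>FrP n\<^esub>"
proof -
  interpret P: group "FrP n" by (rule group_FrP)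
  have "(c, gen (n + 1)) \<in> carrier (FrP n)" using assms by simp
  then show ?thesis
    by (simp add: list_prod_def H_block_def del: one_DirProd carrier_DirProd)
qed

text \<open>Letter by letter, the \<open>W_block\<close> generates the diagonal copy of F_n. Thus
  every \<open>w\<close> has a lift that can conjugate the \<open>R_block\<close> without help from
  the last two entries.\<close>

lemma diagonal_in_generate:
  assumes "w \<in> carrier (Fr n)"
  shows "(w, w) \<in> generate (FrP n) (set (W_block n))"
  using assms
proof (induction w)
  case Nil
  have "([], []) = \<one>\<^bsub>FrP n\<^esub>" by (simp add: one_free_group)
  then show ?case by (metis generate.one)
next
  case (Cons x w)
  obtain i s where x: "x = (i, s)" by (cases x)
  have i: "i \<in> {1..n}" and w: "w \<in> carrier (Fr n)" "reduced (x # w)"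
    using Cons.prems by (auto simp: carrier_free_group reduced_Cons x)
  have g: "(gen i, gen i) \<in> set (W_block n)"
    using i by (auto simp: W_block_def close_up_def set_gens)
  have "([x], [x]) \<in> generate (FrP n) (set (W_block n))"
  proof (cases s)
    case True
    with g show ?thesis by (auto simp: x gen_def intro: generate.incl)
  next
    case False
    have "inv\<^bsub>FrP n\<^esub> (gen i, gen i) = ([x], [x])"
      using i False by (simp add: inv_FrP inv_free_group) (simp add: gen_def x letter_inv_def)
    with g show ?thesis by (metis generate.inv)
  qed
  moreover have "(x # w, x # w) = ([x], [x]) \<otimes>\<^bsub>FrP n\<^esub> (w, w)"
    using w(2) by (simp add: mult_free_group reduce_reduced)
  ultimately show ?case
    using Cons.IH [OF w(1)] by (simp only: generate.eng)
qed

section \<open>Conjugating by elements of the normal closure\<close>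

lemma FTL_tuple_conj_by_conjugate:
  assumes V: "set V \<subseteq> carrier (Fr n)" and v: "v \<in> set V" and w: "w \<in> carrier (Fr n)"
    and c: "c \<in> carrier (Fr n)"
  shows "hurwitz_equiv (FrP n) (FTL_tuple n V c)
    (FTL_tuple n V (conj_by (Fr n) c (conj_by (Fr n) v w)))"
proof -
  interpret F: group "Fr n" by (rule group_free_group)
  interpret P: group "FrP n" by (rule group_FrP)
  let ?vw = "conj_by (Fr n) v w"
  define R R' W where "R = R_block n V" and "R' = map (\<lambda>x. conj_by (FrP n) x (w, w)) R"
    and "W = W_block n"
  have ww: "(w, w) \<in> carrier (FrP n)"
    using w free_group_mono [of "{1..n}" "{1..n + 1}"] by auto
  have vw: "?vw \<in> carrier (Fr n)" using V v w by auto
  have R: "set R \<subseteq> carrier (FrP n)" "list_prod (FrP n) R = \<one>\<^bsub>FrP n\<^esub>"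
    and W: "set W \<subseteq> carrier (FrP n)"
    unfolding R_def W_def
    using R_block_closed [OF V] list_prod_R_block [OF V] W_block_closed by auto
  have R': "set R' \<subseteq> carrier (FrP n)"
  proof
    fix p assume "p \<in> set R'"
    then obtain q where "q \<in> set R" and p: "p = conj_by (FrP n) q (w, w)"
      by (auto simp: R'_def)
    with R(1) have "q \<in> carrier (FrP n)" by blast
    then show "p \<in> carrier (FrP n)" unfolding p using ww by (rule P.conj_by_closed)
  qed
  \<comment> \<open>Kept general in \<open>d\<close>: it is used at \<open>c\<close> and, reversed,
    after the last block has changed.\<close>
  have conj_R: "hurwitz_equiv (FrP n) (R @ W @ H_block n d) (R' @ W @ H_block n d)"
    if d: "d \<in> carrier (Fr n)" for d
  proof -
    have "(w, w) \<in> generate (FrP n) (set ([] @ W @ H_block n d))"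
      using diagonal_in_generate [OF w] P.mono_generate [of "set W" "set ([] @ W @ H_block n d)"]
      by (auto simp: W_def)
    from P.hurwitz_equiv_conj_by_generate [OF this, of R] show ?thesis
      using R W H_block_closed [OF d] by (simp add: R'_def)
  qed
  have g: "(?vw, \<one>\<^bsub>Fr (n + 1)\<^esub>) \<in> set R'"
  proof -
    have "(v, \<one>\<^bsub>Fr (n + 1)\<^esub>) \<in> set R" using v by (auto simp: R_def R_block_def close_up_def)
    moreover have "conj_by (FrP n) (v, \<one>\<^bsub>Fr (n + 1)\<^esub>) (w, w) = (?vw, \<one>\<^bsub>Fr (n + 1)\<^esub>)"
      using ww by (simp add: conj_by_DirProd group_free_group group.conj_by_one_left)
    ultimately show ?thesis unfolding R'_def by force
  qed
  have gc: "(?vw, \<one>\<^bsub>Fr (n + 1)\<^esub>) \<in> carrier (FrP n)" using g R' by blast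
  have cg: "(c, gen (n + 1)) \<in> carrier (FrP n)" using c by simp
  \<comment> \<open>The conjugator has second component 1, so only \<open>c\<close> changes and the
    result is again an \<open>H_block\<close>.\<close>
  have "conj_by (FrP n) (c, gen (n + 1)) (?vw, \<one>\<^bsub>Fr (n + 1)\<^esub>) = (conj_by (Fr n) c ?vw, gen (n + 1))"
    using gc by (simp add: conj_by_DirProd group_free_group group.conj_by_one_right)
  then have HB: "map (\<lambda>x. conj_by (FrP n) x (?vw, \<one>\<^bsub>Fr (n + 1)\<^esub>)) (H_block n c)
      = H_block n (conj_by (Fr n) c ?vw)"
    using P.inv_conj_by [OF cg gc] by (simp add: H_block_def del: inv_DirProd)
  have "hurwitz_equiv (FrP n) ((R' @ W) @ H_block n c @ [])
      ((R' @ W) @ map (\<lambda>x. conj_by (FrP n) x (?vw, \<one>\<^bsub>Fr (n + 1)\<^esub>)) (H_block n c) @ [])"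
    by (rule P.hurwitz_equiv_conj_by_mem)
      (use R' W H_block_closed [OF c] g list_prod_H_block [OF c] in auto)
  then have 2: "hurwitz_equiv (FrP n) (R' @ W @ H_block n c) (R' @ W @ H_block n (conj_by (Fr n) c ?vw))"
    unfolding HB by simp
  have d: "conj_by (Fr n) c ?vw \<in> carrier (Fr n)" using c vw by simp
  have 3: "hurwitz_equiv (FrP n) (R' @ W @ H_block n (conj_by (Fr n) c ?vw))
      (R @ W @ H_block n (conj_by (Fr n) c ?vw))"
    by (rule P.hurwitz_equiv_sym [OF conj_R [OF d]]) (use R W H_block_closed [OF d] in auto)
  have cl: "set (R @ W @ H_block n c) \<subseteq> carrier (FrP n)"
    using R W H_block_closed [OF c] by auto
  show ?thesis
    using P.hurwitz_equiv_trans [OF P.hurwitz_equiv_trans [OF conj_R [OF c] 2 cl] 3 cl]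
    by (simp add: FTL_tuple_def R_def W_def)
qed

lemma FTL_tuple_conj_by_normal_closure:
  assumes V: "set V \<subseteq> carrier (Fr n)" and \<nu>: "\<nu> \<in> normal_closure (Fr n) (set V)"
    and c: "c \<in> carrier (Fr n)"
  shows "hurwitz_equiv (FrP n) (FTL_tuple n V c) (FTL_tuple n V (conj_by (Fr n) c \<nu>))"
proof -
  interpret F: group "Fr n" by (rule group_free_group)
  interpret P: group "FrP n" by (rule group_FrP)
  let ?T = "FTL_tuple n V"
  let ?cj = "conj_by (Fr n)"
  \<comment> \<open>Quantifying over \<open>w\<close> makes \<open>M\<close> closed under
    conjugation, and quantifying over \<open>c\<close> lets successive moves be composed.\<close>
  define M where "M = {\<nu> \<in> carrier (Fr n). \<forall>w\<in>carrier (Fr n). \<forall>c\<in>carrier (Fr n).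
      hurwitz_equiv (FrP n) (?T c) (?T (?cj c (?cj \<nu> w)))}"
  have M: "\<nu> \<in> carrier (Fr n)" "hurwitz_equiv (FrP n) (?T c) (?T (?cj c (?cj \<nu> w)))"
    if "\<nu> \<in> M" "w \<in> carrier (Fr n)" "c \<in> carrier (Fr n)" for \<nu> w c
    using that by (auto simp: M_def)
  have "subgroup M (Fr n)"
  proof (rule F.subgroupI)
    show "M \<subseteq> carrier (Fr n)" by (auto simp: M_def)
    have "\<one>\<^bsub>Fr n\<^esub> \<in> M" by (auto simp: M_def P.hurwitz_equiv_refl)
    then show "M \<noteq> {}" by blast
  next
    fix \<nu> assume \<nu>: "\<nu> \<in> M"
    then have \<nu>c: "\<nu> \<in> carrier (Fr n)" by (simp add: M_def)
    have "hurwitz_equiv (FrP n) (?T c) (?T (?cj c (?cj (inv\<^bsub>Fr n\<^esub> \<nu>) w)))"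
      if w: "w \<in> carrier (Fr n)" and c: "c \<in> carrier (Fr n)" for w c
    proof -
      \<comment> \<open>The move for \<open>\<nu>\<close> started at \<open>?d\<close> leads back to
        \<open>c\<close>, so symmetry gives the move for the inverse.\<close>
      let ?\<mu> = "?cj \<nu> w" and ?d = "?cj c (?cj (inv\<^bsub>Fr n\<^esub> \<nu>) w)"
      have d: "?d = ?cj c (inv\<^bsub>Fr n\<^esub> ?\<mu>)" "?d \<in> carrier (Fr n)"
        using \<nu>c w c by (simp_all add: F.inv_conj_by)
      then have "?cj ?d ?\<mu> = c"
        using \<nu>c w c by simp
      then have "hurwitz_equiv (FrP n) (?T ?d) (?T c)"
        using M(2) [OF \<nu> w d(2)] by simp
      then show ?thesis
        by (rule P.hurwitz_equiv_sym) (rule FTL_tuple_closed [OF V d(2)])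
    qed
    then show "inv\<^bsub>Fr n\<^esub> \<nu> \<in> M" using \<nu>c by (simp add: M_def)
  next
    fix \<nu> \<mu> assume \<nu>: "\<nu> \<in> M" and \<mu>: "\<mu> \<in> M"
    then have cl: "\<nu> \<in> carrier (Fr n)" "\<mu> \<in> carrier (Fr n)" by (simp_all add: M_def)
    have "hurwitz_equiv (FrP n) (?T c) (?T (?cj c (?cj (\<nu> \<otimes>\<^bsub>Fr n\<^esub> \<mu>) w)))"
      if w: "w \<in> carrier (Fr n)" and c: "c \<in> carrier (Fr n)" for w c
    proof -
      have "?cj c (?cj \<nu> w) \<in> carrier (Fr n)" using cl w c by simp
      from P.hurwitz_equiv_trans [OF M(2) [OF \<nu> w c] M(2) [OF \<mu> w this] FTL_tuple_closed [OF V c]]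
      show ?thesis using cl w c by (simp add: F.conj_by_mult_left F.conj_by_mult_right)
    qed
    then show "\<nu> \<otimes>\<^bsub>Fr n\<^esub> \<mu> \<in> M" using cl by (simp add: M_def)
  qed
  moreover have "x \<otimes>\<^bsub>Fr n\<^esub> \<nu> \<otimes>\<^bsub>Fr n\<^esub> inv\<^bsub>Fr n\<^esub> x \<in> M"
    if x: "x \<in> carrier (Fr n)" and \<nu>: "\<nu> \<in> M" for x \<nu>
  proof -
    have \<nu>c: "\<nu> \<in> carrier (Fr n)" using \<nu> by (simp add: M_def)
    have "x \<otimes>\<^bsub>Fr n\<^esub> \<nu> \<otimes>\<^bsub>Fr n\<^esub> inv\<^bsub>Fr n\<^esub> x = ?cj \<nu> (inv\<^bsub>Fr n\<^esub> x)"
      using x by (simp add: conj_by_def)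
    \<comment> \<open>The outer conjugation is absorbed into \<open>w\<close>, which ranges over the
      whole group.\<close>
    moreover have "?cj (?cj \<nu> (inv\<^bsub>Fr n\<^esub> x)) w = ?cj \<nu> (inv\<^bsub>Fr n\<^esub> x \<otimes>\<^bsub>Fr n\<^esub> w)"
      if "w \<in> carrier (Fr n)" for w
      using x \<nu>c that by (simp add: F.conj_by_mult_right)
    ultimately show ?thesis
      using x \<nu>c M(2) [OF \<nu>] by (simp add: M_def)
  qed
  ultimately have "M \<lhd> Fr n" by (simp add: F.normal_inv_iff)
  moreover have "set V \<subseteq> M"
    using V FTL_tuple_conj_by_conjugate [OF V] by (auto simp: M_def)
  ultimately have "\<nu> \<in> M" using \<nu> F.normal_closure_least by blast
  from M(2) [OF this F.one_closed c] M(1) [OF this F.one_closed c] show ?thesis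
    by simp
qed

section \<open>The invariant of a Hurwitz orbit\<close>

lemma exponent_sum_eq_0: "w \<in> carrier (free_group A) \<Longrightarrow> x \<notin> A \<Longrightarrow> exponent_sum x w = 0"
  unfolding exponent_sum_def carrier_free_group
  by (induction w) (auto simp: reduced_Cons)

lemma FTL_tuple_hurwitz_imp_conj_by:
  assumes N: "N \<lhd> Fr n" and V: "set V \<subseteq> N" and c: "c \<in> N"
    and eqv: "hurwitz_equiv (FrP n) (FTL_tuple n V c) (FTL_tuple n V d)"
  shows "\<exists>\<nu>\<in>N. d = conj_by (Fr n) c \<nu>"
proof -
  interpret F: group "Fr n" by (rule group_free_group)
  interpret F': group "Fr (n + 1)" by (rule group_free_group)
  interpret P: group "FrP n" by (rule group_FrP)
  interpret N: normal N "Fr n" by (rule N)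
  interpret r: group_hom "Fr (n + 1)" "Fr n" "retract {1..n}"
    by unfold_locales (rule retract_hom)
  \<comment> \<open>On the R and H entries both cosets are trivial, the latter because
    \<open>c\<close> lies in \<open>N\<close>; on the diagonal W entries they coincide. So
    \<open>K\<close> contains the whole tuple.\<close>
  let ?f = "\<lambda>p. N #>\<^bsub>Fr n\<^esub> fst p" and ?f' = "\<lambda>p. N #>\<^bsub>Fr n\<^esub> retract {1..n} (snd p)"
  define K where "K = {p \<in> carrier (FrP n). ?f p = ?f' p}"
  have "?f \<in> hom (FrP n) (Fr n Mod N)" "?f' \<in> hom (FrP n) (Fr n Mod N)"
    using N.r_coset_hom_Mod by (auto simp: hom_def mult_DirProd')
  then have K: "subgroup K (FrP n)"
    unfolding K_def by (rule P.subgroup_equalizer) (rule N.factorgroup_is_group)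
  have NK: "N #>\<^bsub>Fr n\<^esub> u = N #>\<^bsub>Fr n\<^esub> \<one>\<^bsub>Fr n\<^esub>" if "u \<in> N" for u
    using that F.coset_join2 [of u N] F.coset_join2 [of "\<one>\<^bsub>Fr n\<^esub>" N] N.subgroup_axioms
    by simp
  have "set (R_block n V) \<subseteq> K"
  proof
    fix p assume "p \<in> set (R_block n V)"
    then obtain u where p: "p = (u, \<one>\<^bsub>Fr (n + 1)\<^esub>)" "u \<in> N"
      using F.close_up_in_subgroup [OF N.subgroup_axioms V] by (auto simp: R_block_def)
    then show "p \<in> K" using NK [OF p(2)] N.mem_carrier [OF p(2)] by (simp add: K_def)
  qed
  moreover have "set (W_block n) \<subseteq> K"
  proof
    fix p assume p: "p \<in> set (W_block n)"
    then obtain u where u: "p = (u, u)" "u \<in> carrier (Fr n)"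
      using F.set_close_up [OF gens_closed] by (auto simp: W_block_def)
    with W_block_closed [of n] p show "p \<in> K" by (auto simp: K_def retract_id)
  qed
  moreover have "set (H_block n c) \<subseteq> K"
  proof -
    have "(c, gen (n + 1)) \<in> K"
      using NK [OF c] N.mem_carrier [OF c] by (simp add: K_def retract_gen one_free_group)
    with K show ?thesis by (simp add: H_block_def subgroup.m_inv_closed del: inv_DirProd)
  qed
  ultimately have "set (FTL_tuple n V c) \<subseteq> K" by (simp add: FTL_tuple_def)
  moreover have "(d, gen (n + 1)) \<in> set (FTL_tuple n V d)"
    by (simp add: FTL_tuple_def H_block_def)
  ultimately obtain x g where x: "x \<in> set (FTL_tuple n V c)" and g: "g \<in> K"
    and xg: "(d, gen (n + 1)) = conj_by (FrP n) x g"
    using P.hurwitz_equiv_conj_by_subgroup [OF eqv K] by blast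
  obtain g1 g2 where g12: "g = (g1, g2)" by (cases g)
  with g have gc: "g1 \<in> carrier (Fr n)" "g2 \<in> carrier (Fr (n + 1))"
    and geq: "N #>\<^bsub>Fr n\<^esub> g1 = N #>\<^bsub>Fr n\<^esub> retract {1..n} g2"
    by (auto simp: K_def)
  obtain x1 x2 where x12: "x = (x1, x2)" by (cases x)
  have d: "d = conj_by (Fr n) x1 g1" and x2: "gen (n + 1) = conj_by (Fr (n + 1)) x2 g2"
    using xg gc by (simp_all add: x12 g12 conj_by_DirProd group_free_group)
  \<comment> \<open>Conjugation preserves this sum. It is 0 on the first two blocks and -1 on the
    inverse entry, which leaves only \<open>(c, gen (n + 1))\<close> as the source.\<close>
  have "exponent_sum (n + 1) x2 = 1"
    using arg_cong [OF x2, of "exponent_sum (n + 1)"] gc by (simp add: exponent_sum_gen)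
  moreover have "exponent_sum (n + 1) u = 0" if "u \<in> set (close_up (Fr n) (gens n))" for u
    using that F.set_close_up [OF gens_closed] by (intro exponent_sum_eq_0) auto
  ultimately have xH: "x1 = c" "x2 = gen (n + 1)"
    using x c by (auto simp: x12 FTL_tuple_def R_block_def W_block_def H_block_def
        one_free_group group_free_group exponent_sum_gen)
  have "gen (n + 1) \<otimes>\<^bsub>Fr (n + 1)\<^esub> g2 = g2 \<otimes>\<^bsub>Fr (n + 1)\<^esub> gen (n + 1)"
    using x2 gc xH F'.conj_by_eq_self_iff [of "gen (n + 1)" g2] by simp
  moreover have "gen (n + 1) \<in> carrier (Fr (n + 1))" by simp
  ultimately obtain k :: int where "g2 = gen (n + 1) [^]\<^bsub>Fr (n + 1)\<^esub> k"
    using free_group_commute_imp_power [OF _ not_has_root_gen gc(2)] by blast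
  \<comment> \<open>The generator \<open>n + 1\<close> lies outside \<open>{1..n}\<close>, so the
    retraction kills all its powers; membership in \<open>K\<close> then puts \<open>g1\<close> into
    \<open>N\<close>.\<close>
  then have "retract {1..n} g2 = \<one>\<^bsub>Fr n\<^esub>"
    using r.hom_int_pow [of "gen (n + 1)" k] by (simp add: retract_gen flip: one_free_group [of "{1..n}"])
  then have "N #>\<^bsub>Fr n\<^esub> g1 = N"
    using geq F.coset_join2 [of "\<one>\<^bsub>Fr n\<^esub>" N] N.subgroup_axioms by simp
  then have "g1 \<in> N" using F.rcos_self [OF gc(1) N.subgroup_axioms] by simp
  with d xH show ?thesis by blast
qed

section \<open>Membership in the normal closure read off from Hurwitz orbits\<close>

theorem theorem4p6:
  fixes n :: nat and V :: "nat word list" and H a b :: "nat word"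
    and \<iota> :: "nat word \<times> nat word \<Rightarrow> nat word \<times> nat word"
  assumes "n \<ge> 2"
    and "set V \<subseteq> carrier (Fr n)"
    and "\<exists>v\<in>set V. v \<noteq> \<one>\<^bsub>Fr n\<^esub>"
    and "\<iota> \<in> mon (Fr n \<times>\<times> Fr (n + 1)) (Fr 2 \<times>\<times> Fr 2)"
    and "H \<in> normal_closure (Fr n) (set V)"
    and "\<not> has_root (Fr n) H"
    and "a \<in> carrier (Fr n)" and "b \<in> carrier (Fr n)"
  shows "hurwitz_equiv (Fr 2 \<times>\<times> Fr 2) (FTL_s2 \<iota> H n V a) (FTL_s2 \<iota> H n V b)
    \<longleftrightarrow> inv\<^bsub>Fr n\<^esub> a \<otimes>\<^bsub>Fr n\<^esub> b \<in> normal_closure (Fr n) (set V)"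
proof -
  let ?N = "normal_closure (Fr n) (set V)"
  let ?cj = "conj_by (Fr n)"
  note V = assms(2) and a = assms(7) and b = assms(8)
  interpret F: group "Fr n" by (rule group_free_group)
  interpret N: normal ?N "Fr n" by (rule F.normal_closure_normal [OF V])
  interpret \<iota>: group_hom "FrP n" "Fr 2 \<times>\<times> Fr 2" \<iota>
    using assms(4) by (simp add: group_hom_def group_hom_axioms_def mon_def DirProd_group group_free_group)
  have inj: "inj_on \<iota> (carrier (FrP n))" using assms(4) by (simp add: mon_def)
  have H: "H \<in> carrier (Fr n)" using assms(5) N.subset by blast
  have Ha: "?cj H a \<in> carrier (Fr n)" and Hb: "?cj H b \<in> carrier (Fr n)"
    using H a b by auto
  have HaN: "?cj H a \<in> ?N"
    using assms(5) a N.inv_op_closed1 by (simp add: conj_by_def)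
  have "hurwitz_equiv (Fr 2 \<times>\<times> Fr 2) (FTL_s2 \<iota> H n V a) (FTL_s2 \<iota> H n V b)
      \<longleftrightarrow> hurwitz_equiv (FrP n) (FTL_tuple n V (?cj H a)) (FTL_tuple n V (?cj H b))"
    unfolding FTL_s2_def FTL_s1_eq [OF Ha] FTL_s1_eq [OF Hb]
    by (intro \<iota>.hurwitz_equiv_map_iff inj FTL_tuple_closed V Ha Hb)
  also have "\<dots> \<longleftrightarrow> inv\<^bsub>Fr n\<^esub> a \<otimes>\<^bsub>Fr n\<^esub> b \<in> ?N"
  proof
    assume "hurwitz_equiv (FrP n) (FTL_tuple n V (?cj H a)) (FTL_tuple n V (?cj H b))"
    then obtain \<nu> where \<nu>: "\<nu> \<in> ?N" "?cj H b = ?cj (?cj H a) \<nu>"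
      using FTL_tuple_hurwitz_imp_conj_by [OF N.normal_axioms F.normal_closure_incl HaN] by blast
    have \<nu>c: "\<nu> \<in> carrier (Fr n)" using \<nu>(1) N.subset by blast
    \<comment> \<open>Since H^(a \<nu>) = H^b, conjugation by this element fixes \<open>H\<close>;
      being rootless, \<open>H\<close> has only its own powers as centralizer, and these lie in
      \<open>N\<close>.\<close>
    define m where "m = a \<otimes>\<^bsub>Fr n\<^esub> \<nu> \<otimes>\<^bsub>Fr n\<^esub> inv\<^bsub>Fr n\<^esub> b"
    have m: "m \<in> carrier (Fr n)" using a b \<nu>c by (simp add: m_def)
    have "?cj H m = ?cj (?cj H b) (inv\<^bsub>Fr n\<^esub> b)"
      using H a b \<nu>c by (simp add: m_def F.conj_by_mult_right \<nu>(2))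
    then have "?cj H m = H" using H b by simp
    then obtain k :: int where "m = H [^]\<^bsub>Fr n\<^esub> k"
      using free_group_commute_imp_power [OF H assms(6) m] F.conj_by_eq_self_iff [OF H m] by blast
    then have mN: "m \<in> ?N"
      using F.subgroup_int_pow_closed [OF N.subgroup_axioms assms(5)] by simp
    \<comment> \<open>Solving m b = a \<nu> gives a^-1 b = (a^-1 m^-1 a) \<nu>, a product of two
      elements of \<open>N\<close>.\<close>
    have "?cj (inv\<^bsub>Fr n\<^esub> m) a \<in> ?N"
      using mN a N.inv_op_closed1 by (simp add: conj_by_def N.m_inv_closed)
    then have "?cj (inv\<^bsub>Fr n\<^esub> m) a \<otimes>\<^bsub>Fr n\<^esub> \<nu> \<in> ?N" using \<nu>(1) by simp
    moreover have "m \<otimes>\<^bsub>Fr n\<^esub> b = a \<otimes>\<^bsub>Fr n\<^esub> \<nu>"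
      using a b \<nu>c by (simp add: m_def F.m_assoc)
    then have "inv\<^bsub>Fr n\<^esub> m \<otimes>\<^bsub>Fr n\<^esub> (a \<otimes>\<^bsub>Fr n\<^esub> \<nu>) = b"
      using m a b \<nu>c by (simp add: F.inv_solve_left')
    then have "?cj (inv\<^bsub>Fr n\<^esub> m) a \<otimes>\<^bsub>Fr n\<^esub> \<nu> = inv\<^bsub>Fr n\<^esub> a \<otimes>\<^bsub>Fr n\<^esub> b"
      using m a b \<nu>c by (simp add: conj_by_def F.m_assoc)
    ultimately show "inv\<^bsub>Fr n\<^esub> a \<otimes>\<^bsub>Fr n\<^esub> b \<in> ?N" by simp
  next
    assume \<nu>: "inv\<^bsub>Fr n\<^esub> a \<otimes>\<^bsub>Fr n\<^esub> b \<in> ?N"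
    have "?cj (?cj H a) (inv\<^bsub>Fr n\<^esub> a \<otimes>\<^bsub>Fr n\<^esub> b) = ?cj H b"
      using H a b by (simp add: F.conj_by_mult_right)
    with FTL_tuple_conj_by_normal_closure [OF V \<nu> Ha]
    show "hurwitz_equiv (FrP n) (FTL_tuple n V (?cj H a)) (FTL_tuple n V (?cj H b))" by simp
  qed
  finally show ?thesis .
qed

end
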